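(* Let $G$ be a finitely generated group with finite asymptotic dimension. Then $G$ has the patching property.
   Context: Fix a finite symmetric generating set of $G$, and let $B_r$ be the ball of radius $r$ around $1_G$ for the left-invariant word metric. For $A \subset G$ write $A^{\circ r} = \{a \in G : aB_r \subset A\}$. The $r$-almost-union of $A, B \subset G$ is $$A \overset{r}{\cup} B = A^{\circ r} \cup B^{\circ r} \cup \big((A \cup B) \setminus (AB_r \cap BB_r)\big).$$ For $r, R \in \mathbb{N}$ let $\mathcal{C}_{r,R}$ be the smallest family of subsets of $G$ which contains all left translates $aB_R$, $a \in G$, and is closed under the $r$-almost-union operation and under taking subsets. $G$ has the patching property if for all $r$ there exists $R$ such that $\mathcal{C}_{r,R}$ contains all balls of radius larger than $R$. (This does not depend on the choice of generating set.) Asymptotic dimension is Gromov's: the infimum of all $d \in \mathbb{N}$ such that for all $r$ there exist $m$ and a coloring $x : G \to \{1,\ldots,d+1\}$ such that for each color $c$, the graph with vertex set $\{a \in G : x_a = c\}$ and edges between $a, b$ at word distance at most $r$ has all connected components of cardinality at most $m$. *)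

theory Defs
  imports "HOL-Algebra.Algebra" "HOL-Library.Extended_Nat"
begin

definition finite_symmetric_generating_set :: "('a, 'b) monoid_scheme \<Rightarrow> 'a set \<Rightarrow> bool" where
  "finite_symmetric_generating_set G S \<longleftrightarrow>
     finite S \<and> S \<subseteq> carrier G \<and> (\<forall>s\<in>S. inv\<^bsub>G\<^esub> s \<in> S) \<and> generate G S = carrier G"

text \<open>
  The \<open>LEAST\<close> below is meaningful on \<open>carrier G\<close> when \<open>S\<close> is a symmetric generating
  set: every element is then a product of a word over \<open>S\<close>.
\<close>

definition word_length :: "('a, 'b) monoid_scheme \<Rightarrow> 'a set \<Rightarrow> 'a \<Rightarrow> nat" where
  "word_length G S g =
     (LEAST n. \<exists>ws. length ws = n \<and> set ws \<subseteq> S \<and> foldr (\<otimes>\<^bsub>G\<^esub>) ws \<one>\<^bsub>G\<^esub> = g)"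

definition word_dist :: "('a, 'b) monoid_scheme \<Rightarrow> 'a set \<Rightarrow> 'a \<Rightarrow> 'a \<Rightarrow> nat" where
  "word_dist G S a b = word_length G S (inv\<^bsub>G\<^esub> a \<otimes>\<^bsub>G\<^esub> b)"

definition word_ball :: "('a, 'b) monoid_scheme \<Rightarrow> 'a set \<Rightarrow> nat \<Rightarrow> 'a set" where
  "word_ball G S r = {g \<in> carrier G. word_dist G S \<one>\<^bsub>G\<^esub> g \<le> r}"

definition set_interior :: "('a, 'b) monoid_scheme \<Rightarrow> 'a set \<Rightarrow> nat \<Rightarrow> 'a set \<Rightarrow> 'a set" where
  "set_interior G S r A = {a \<in> carrier G. a <#\<^bsub>G\<^esub> word_ball G S r \<subseteq> A}"

definition almost_union ::
    "('a, 'b) monoid_scheme \<Rightarrow> 'a set \<Rightarrow> nat \<Rightarrow> 'a set \<Rightarrow> 'a set \<Rightarrow> 'a set" where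
  "almost_union G S r A B =
     set_interior G S r A \<union> set_interior G S r B \<union>
     ((A \<union> B) - ((A <#>\<^bsub>G\<^esub> word_ball G S r) \<inter> (B <#>\<^bsub>G\<^esub> word_ball G S r)))"

inductive_set patch_family ::
    "('a, 'b) monoid_scheme \<Rightarrow> 'a set \<Rightarrow> nat \<Rightarrow> nat \<Rightarrow> 'a set set"
  for G :: "('a, 'b) monoid_scheme" and S :: "'a set" and r R :: nat where
  translate: "a \<in> carrier G \<Longrightarrow> a <#\<^bsub>G\<^esub> word_ball G S R \<in> patch_family G S r R"
| almost_union: "A \<in> patch_family G S r R \<Longrightarrow> B \<in> patch_family G S r R \<Longrightarrow>
    almost_union G S r A B \<in> patch_family G S r R"
| subset: "A \<in> patch_family G S r R \<Longrightarrow> B \<subseteq> A \<Longrightarrow> B \<in> patch_family G S r R"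

text \<open>The ball of radius \<open>n\<close> around \<open>a\<close> is \<open>a <# word_ball G S n\<close>, by left-invariance.\<close>

definition patching_property :: "('a, 'b) monoid_scheme \<Rightarrow> 'a set \<Rightarrow> bool" where
  "patching_property G S \<longleftrightarrow>
     (\<forall>r. \<exists>R. \<forall>n>R. \<forall>a\<in>carrier G. a <#\<^bsub>G\<^esub> word_ball G S n \<in> patch_family G S r R)"

text \<open>
  Vertex sets of the connected components of the graph on \<open>V\<close> joining points at word
  distance at most \<open>r\<close>: the classes of the reflexive-transitive closure of adjacency,
  which is symmetric because \<open>word_dist\<close> is.
\<close>

definition scale_components ::
    "('a, 'b) monoid_scheme \<Rightarrow> 'a set \<Rightarrow> nat \<Rightarrow> 'a set \<Rightarrow> 'a set set" where
  "scale_components G S r V = V // {(a, b). a \<in> V \<and> b \<in> V \<and> word_dist G S a b \<le> r}\<^sup>*"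

definition asdim_at_most :: "('a, 'b) monoid_scheme \<Rightarrow> 'a set \<Rightarrow> nat \<Rightarrow> bool" where
  "asdim_at_most G S d \<longleftrightarrow>
     (\<forall>r. \<exists>m. \<exists>x :: 'a \<Rightarrow> nat. x \<in> carrier G \<rightarrow> {1..d + 1} \<and>
        (\<forall>c\<in>{1..d + 1}. \<forall>K\<in>scale_components G S r {a \<in> carrier G. x a = c}.
           finite K \<and> card K \<le> m))"

text \<open>The infimum is \<open>\<infinity>\<close> when no \<open>d\<close> qualifies.\<close>

definition asdim :: "('a, 'b) monoid_scheme \<Rightarrow> 'a set \<Rightarrow> enat" where
  "asdim G S = Inf (enat ` {d. asdim_at_most G S d})"

end

(* A colour class whose components at a large scale are bounded is a disjoint union of
   uniformly bounded, far-apart pieces, and this persists after thickening it by s. Almost-union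
   agrees with union on sets at distance more than r, so finite parts of thickened colour classes
   are in the family. Combining different colours by almost-union loses at most r of
   the thickening, because the almost-union contains both r-interiors. Starting with thickness
   (d + 1) * r therefore leaves room to merge all d + 1 colours. *)

theory Submission
  imports Defs
begin

locale word_metric_group = group G for G :: "('a, 'b) monoid_scheme" (structure) +
  fixes S :: "'a set"
  assumes generating: "finite_symmetric_generating_set G S"
begin

abbreviation len :: "'a \<Rightarrow> nat" where "len \<equiv> word_length G S"
abbreviation wdist :: "'a \<Rightarrow> 'a \<Rightarrow> nat" where "wdist \<equiv> word_dist G S"
abbreviation ball :: "nat \<Rightarrow> 'a set" where "ball \<equiv> word_ball G S"
abbreviation eval_word :: "'a list \<Rightarrow> 'a" where "eval_word ws \<equiv> foldr (\<otimes>) ws \<one>"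

section \<open>Words over the generators and word length\<close>

lemma finite_generators: "finite S"
  and generators_closed: "S \<subseteq> carrier G"
  and generators_inv: "s \<in> S \<Longrightarrow> inv s \<in> S"
  and generate_generators: "generate G S = carrier G"
  using generating by (auto simp: finite_symmetric_generating_set_def)

lemma eval_word_closed: "set ws \<subseteq> S \<Longrightarrow> eval_word ws \<in> carrier G"
  using generators_closed by (induction ws) auto

lemma eval_word_append:
  "set us \<subseteq> S \<Longrightarrow> set ws \<subseteq> S \<Longrightarrow> eval_word (us @ ws) = eval_word us \<otimes> eval_word ws"
proof (induction us)
  case (Cons u us)
  then have "u \<in> carrier G" using generators_closed by auto
  with Cons show ?case by (simp add: m_assoc eval_word_closed)
qed (simp add: eval_word_closed)

lemma eval_word_inverse:
  "set ws \<subseteq> S \<Longrightarrow> eval_word (rev (map (\<lambda>s. inv s) ws)) = inv (eval_word ws)"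
proof (induction ws)
  case (Cons w ws)
  then have w: "w \<in> carrier G" "inv w \<in> S" using generators_closed generators_inv by auto
  have "set (rev (map (\<lambda>s. inv s) ws)) \<subseteq> S" using Cons.prems generators_inv by auto
  then have "eval_word (rev (map (\<lambda>s. inv s) (w # ws))) = inv (eval_word ws) \<otimes> inv w"
    using eval_word_append[of "rev (map (\<lambda>s. inv s) ws)" "[inv w]"] Cons w by simp
  then show ?case
    using w Cons.prems by (simp add: inv_mult_group eval_word_closed)
qed simp

text \<open>Symmetry of \<open>S\<close> turns each inverse allowed in \<open>generate\<close> into
  a letter. Hence the \<open>LEAST\<close> in \<open>word_length\<close> is attained on the whole
  carrier, which \<open>shortest_word\<close> exploits.\<close>

lemma word_exists:
  assumes "g \<in> carrier G"
  shows "\<exists>ws. set ws \<subseteq> S \<and> eval_word ws = g"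
proof -
  have "g \<in> generate G S" using assms generate_generators by simp
  then show ?thesis
  proof (induction rule: generate.induct)
    case one
    show ?case by (rule exI[of _ "[]"]) simp
  next
    case (incl h)
    then show ?case using generators_closed by (intro exI[of _ "[h]"]) auto
  next
    case (inv h)
    then show ?case using generators_closed generators_inv by (intro exI[of _ "[inv h]"]) auto
  next
    case (eng h1 h2)
    then obtain us ws where "set us \<subseteq> S" "eval_word us = h1" "set ws \<subseteq> S" "eval_word ws = h2"
      by blast
    then show ?case using eval_word_append by (intro exI[of _ "us @ ws"]) auto
  qed
qed

lemma shortest_word:
  assumes "g \<in> carrier G"
  obtains ws where "length ws = len g" "set ws \<subseteq> S" "eval_word ws = g"
proof -
  have "\<exists>n ws. length ws = n \<and> set ws \<subseteq> S \<and> eval_word ws = g"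
    using word_exists[OF assms] by blast
  from LeastI_ex[OF this] show thesis using that unfolding word_length_def by blast
qed

lemma len_le: "set ws \<subseteq> S \<Longrightarrow> len (eval_word ws) \<le> length ws"
  unfolding word_length_def by (rule Least_le) blast

lemma len_mult:
  assumes "g \<in> carrier G" "h \<in> carrier G"
  shows "len (g \<otimes> h) \<le> len g + len h"
proof -
  obtain us ws where "length us = len g" "set us \<subseteq> S" "eval_word us = g"
    "length ws = len h" "set ws \<subseteq> S" "eval_word ws = h"
    using assms shortest_word by metis
  then show ?thesis using len_le[of "us @ ws"] eval_word_append[of us ws] by simp
qed

lemma len_inv_le:
  assumes "g \<in> carrier G"
  shows "len (inv g) \<le> len g"
proof -
  obtain ws where ws: "length ws = len g" "set ws \<subseteq> S" "eval_word ws = g"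
    using assms shortest_word by metis
  then have "set (rev (map (\<lambda>s. inv s) ws)) \<subseteq> S" using generators_inv by auto
  from len_le[OF this] show ?thesis using eval_word_inverse ws by simp
qed

lemma len_one: "len \<one> = 0"
  using len_le[of "[]"] by simp

section \<open>The word metric, balls and thickenings\<close>

lemma wdist_self: "a \<in> carrier G \<Longrightarrow> wdist a a = 0"
  by (simp add: word_dist_def len_one)

lemma wdist_commute:
  assumes "a \<in> carrier G" "b \<in> carrier G"
  shows "wdist a b = wdist b a"
proof -
  have "wdist x y \<le> wdist y x" if "x \<in> carrier G" "y \<in> carrier G" for x y
    using len_inv_le[of "inv y \<otimes> x"] that by (simp add: word_dist_def inv_mult_group)
  with assms show ?thesis by (simp add: antisym)
qed

lemma wdist_triangle:
  assumes "a \<in> carrier G" "b \<in> carrier G" "c \<in> carrier G"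
  shows "wdist a c \<le> wdist a b + wdist b c"
proof -
  have "inv a \<otimes> c = (inv a \<otimes> b) \<otimes> (inv b \<otimes> c)"
    using assms by (metis inv_closed m_assoc m_closed r_inv r_one)
  then show ?thesis using len_mult[of "inv a \<otimes> b" "inv b \<otimes> c"] assms
    by (simp add: word_dist_def)
qed

lemma mem_translate_iff:
  assumes "a \<in> carrier G"
  shows "b \<in> a <# ball r \<longleftrightarrow> b \<in> carrier G \<and> wdist a b \<le> r"
proof
  assume "b \<in> a <# ball r"
  then obtain h where "h \<in> carrier G" "wdist \<one> h \<le> r" "b = a \<otimes> h"
    by (auto simp: l_coset_def word_ball_def)
  then show "b \<in> carrier G \<and> wdist a b \<le> r"
    using assms by (simp add: word_dist_def m_assoc[symmetric])
next
  assume b: "b \<in> carrier G \<and> wdist a b \<le> r"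
  then have "inv a \<otimes> b \<in> ball r" using assms by (simp add: word_ball_def word_dist_def)
  moreover have "b = a \<otimes> (inv a \<otimes> b)" using b assms by (simp add: m_assoc[symmetric])
  ultimately show "b \<in> a <# ball r" by (auto simp: l_coset_def)
qed

text \<open>Right multiplication by a ball is the metric neighbourhood, since the metric is
  left-invariant. From here on, products with balls are handled through distances alone.\<close>

lemma mem_thickening_iff:
  assumes "A \<subseteq> carrier G"
  shows "b \<in> A <#> ball r \<longleftrightarrow> b \<in> carrier G \<and> (\<exists>a\<in>A. wdist a b \<le> r)"
proof -
  have "b \<in> A <#> ball r \<longleftrightarrow> (\<exists>a\<in>A. b \<in> a <# ball r)"
    by (auto simp: set_mult_def l_coset_def)
  then show ?thesis using mem_translate_iff assms by blast
qed

lemma thickening_closed: "A \<subseteq> carrier G \<Longrightarrow> A <#> ball r \<subseteq> carrier G"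
  using mem_thickening_iff by blast

lemma thickening_mono:
  "A \<subseteq> B \<Longrightarrow> r \<le> s \<Longrightarrow> A <#> ball r \<subseteq> B <#> ball s"
  by (rule mono_set_mult) (auto simp: word_ball_def)

lemma subset_thickening:
  assumes "A \<subseteq> carrier G"
  shows "A \<subseteq> A <#> ball r"
proof
  fix a assume "a \<in> A"
  moreover from this have "a \<in> carrier G" "wdist a a \<le> r" using assms wdist_self by auto
  ultimately show "a \<in> A <#> ball r" using mem_thickening_iff[OF assms] by blast
qed

text \<open>A finite alphabet has only finitely many words of bounded length, and shortest words map
  onto the ball.\<close>

lemma finite_ball: "finite (ball r)"
proof (rule finite_subset)
  show "ball r \<subseteq> eval_word ` {ws. set ws \<subseteq> S \<and> length ws \<le> r}"
  proof
    fix g assume "g \<in> ball r"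
    then have g: "g \<in> carrier G" "len g \<le> r" by (auto simp: word_ball_def word_dist_def)
    obtain ws where "length ws = len g" "set ws \<subseteq> S" "eval_word ws = g"
      using shortest_word[OF g(1)] .
    with g show "g \<in> eval_word ` {ws. set ws \<subseteq> S \<and> length ws \<le> r}" by auto
  qed
  show "finite (eval_word ` {ws. set ws \<subseteq> S \<and> length ws \<le> r})"
    using finite_lists_length_le[OF finite_generators] by simp
qed

text \<open>The triangle inequality. This is the source of the loss of \<open>r\<close> in each
  merge of colours.\<close>

lemma thickening_subset_interior:
  assumes "A \<subseteq> carrier G"
  shows "A <#> ball s \<subseteq> set_interior G S r (A <#> ball (s + r))"
proof
  fix b assume "b \<in> A <#> ball s"
  then obtain a where a: "a \<in> A" "wdist a b \<le> s" and b: "b \<in> carrier G"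
    using mem_thickening_iff assms by auto
  have "c \<in> A <#> ball (s + r)" if "c \<in> b <# ball r" for c
  proof -
    have "c \<in> carrier G" "wdist b c \<le> r" using that mem_translate_iff b by auto
    moreover from this have "wdist a c \<le> s + r"
      using wdist_triangle[of a b c] a b assms by force
    ultimately show ?thesis using mem_thickening_iff assms a by blast
  qed
  then show "b \<in> set_interior G S r (A <#> ball (s + r))"
    using b by (auto simp: set_interior_def)
qed

section \<open>Almost-unions of far-apart sets\<close>

text \<open>Each set misses the \<open>r\<close>-thickening of the other, so the intersection of the
  two thickenings, which is what the almost-union removes, meets neither set.\<close>

lemma almost_union_separated:
  assumes "A \<subseteq> carrier G" "B \<subseteq> carrier G"
    and "\<And>a b. a \<in> A \<Longrightarrow> b \<in> B \<Longrightarrow> r < wdist a b"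
  shows "A \<union> B \<subseteq> almost_union G S r A B"
proof -
  have "a \<notin> B <#> ball r" if "a \<in> A" for a
    using that assms mem_thickening_iff[OF assms(2)] wdist_commute[of a]
    by (metis linorder_not_le subsetD)
  moreover have "b \<notin> A <#> ball r" if "b \<in> B" for b
    using that assms mem_thickening_iff[OF assms(1)] by (metis linorder_not_le)
  ultimately show ?thesis by (auto simp: almost_union_def)
qed

lemma patch_family_empty: "{} \<in> patch_family G S r R"
  using patch_family.subset[OF patch_family.translate[OF one_closed]] by blast

text \<open>Pairwise separation keeps the next member far from the union of the earlier ones, so
  members can be added one at a time by almost-union.\<close>

lemma patch_family_separated_Union:
  assumes "finite F"
    and "\<And>A. A \<in> F \<Longrightarrow> A \<in> patch_family G S r R"
    and "\<And>A. A \<in> F \<Longrightarrow> A \<subseteq> carrier G"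
    and "\<And>A B a b. A \<in> F \<Longrightarrow> B \<in> F \<Longrightarrow> A \<noteq> B \<Longrightarrow> a \<in> A \<Longrightarrow> b \<in> B \<Longrightarrow> r < wdist a b"
  shows "\<Union>F \<in> patch_family G S r R"
  using assms
proof (induction F rule: finite_induct)
  case empty
  then show ?case using patch_family_empty by simp
next
  case (insert A F)
  have "A \<union> \<Union>F \<subseteq> almost_union G S r A (\<Union>F)"
  proof (rule almost_union_separated)
    fix a b assume "a \<in> A" "b \<in> \<Union>F"
    then show "r < wdist a b" using insert.prems(3)[of A] insert.hyps(2) by blast
  qed (use insert.prems(2) in auto)
  moreover have "\<Union>F \<in> patch_family G S r R"
    using insert.IH insert.prems by (metis insert_iff)
  then have "almost_union G S r A (\<Union>F) \<in> patch_family G S r R"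
    using patch_family.almost_union insert.prems(1) by blast
  ultimately show ?case
    using patch_family.subset by (metis Union_insert)
qed

section \<open>Components of the graph at a fixed scale\<close>

definition adj :: "nat \<Rightarrow> 'a set \<Rightarrow> ('a \<times> 'a) set" where
  "adj r V = {(a, b). a \<in> V \<and> b \<in> V \<and> wdist a b \<le> r}"

lemma sym_adj: "V \<subseteq> carrier G \<Longrightarrow> sym (adj r V)"
  using wdist_commute by (auto simp: adj_def sym_def subset_iff)

lemma adj_component_subset: "a \<in> V \<Longrightarrow> (adj r V)\<^sup>* `` {a} \<subseteq> V"
  by (auto simp: adj_def elim: rtranclE)

lemma wdist_relpow_adj:
  assumes "V \<subseteq> carrier G" "a \<in> V" "(a, b) \<in> adj r V ^^ n"
  shows "b \<in> V \<and> wdist a b \<le> n * r"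
  using assms(3)
proof (induction n arbitrary: b)
  case 0
  then show ?case using assms wdist_self by auto
next
  case (Suc n)
  from Suc.prems obtain c where c: "(a, c) \<in> adj r V ^^ n" "(c, b) \<in> adj r V"
    by (rule relpow_Suc_E)
  have "b \<in> V" "wdist c b \<le> r" using c(2) by (simp_all add: adj_def)
  moreover have "c \<in> V" "wdist a c \<le> n * r" using Suc.IH[OF c(1)] by simp_all
  moreover from calculation have "wdist a b \<le> wdist a c + wdist c b"
    using assms(1,2) by (intro wdist_triangle) auto
  ultimately show ?case by simp
qed

text \<open>Converts a bound on cardinality into one on diameter: a chain inside the component can
  be chosen with at most as many steps as there are adjacent pairs, at most \<open>m * m\<close>,
  and each step has length at most \<open>r\<close>.\<close>

lemma adj_component_bounded:
  assumes V: "V \<subseteq> carrier G" "a \<in> V"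
    and K: "finite ((adj r V)\<^sup>* `` {a})" "card ((adj r V)\<^sup>* `` {a}) \<le> m"
    and b: "(a, b) \<in> (adj r V)\<^sup>*"
  shows "wdist a b \<le> m * m * r"
proof -
  define K where "K = (adj r V)\<^sup>* `` {a}"
  have KV: "K \<subseteq> V" using adj_component_subset V by (simp add: K_def)
  have adjK: "adj r K \<subseteq> K \<times> K" by (auto simp: adj_def)
  have fin: "finite K" "card K \<le> m" using K by (simp_all add: K_def)
  have finE: "finite (adj r K)" using adjK fin finite_subset by blast
  have "card (adj r K) \<le> card (K \<times> K)" using adjK fin by (intro card_mono) auto
  also have "\<dots> \<le> m * m" using fin by (simp add: card_cartesian_product mult_le_mono)
  finally have cE: "card (adj r K) \<le> m * m" .
  \<comment> \<open>A chain starting at \<open>a\<close> never leaves its component, so it may be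
    taken in the finite relation \<open>adj r K\<close>, whereas \<open>adj r V\<close> may be
    infinite.\<close>
  have "(a, b) \<in> (adj r K)\<^sup>*"
    using b
  proof (induction rule: rtrancl_induct)
    case (step y z)
    then have "(y, z) \<in> adj r K" by (auto simp: adj_def K_def intro: rtrancl.rtrancl_into_rtrancl)
    with step.IH show ?case by (rule rtrancl.rtrancl_into_rtrancl)
  qed simp
  then obtain n where n: "n \<le> card (adj r K)" "(a, b) \<in> adj r K ^^ n"
    using rtrancl_finite_eq_relpow[OF finE] by auto
  have "wdist a b \<le> n * r"
    using wdist_relpow_adj[OF _ _ n(2)] KV V by (auto simp: K_def)
  also have "\<dots> \<le> m * m * r" using n(1) cE by (intro mult_le_mono) auto
  finally show ?thesis .
qed

section \<open>Thickened finite parts of one colour class\<close>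

text \<open>Distinct components at scale \<open>2 * s + r\<close> stay more than \<open>r\<close>
  apart after both are thickened by \<open>s\<close>. The radius is the diameter bound of a
  component plus \<open>s\<close>, so it does not depend on \<open>P\<close>.\<close>

lemma thickened_finite_subset_in_patch_family:
  assumes V: "V \<subseteq> carrier G" and P: "finite P" "P \<subseteq> V"
    and bdd: "\<And>K. K \<in> scale_components G S (2 * s + r) V \<Longrightarrow> finite K \<and> card K \<le> m"
  shows "P <#> ball s \<in> patch_family G S r (m * m * (2 * s + r) + s)"
proof -
  let ?t = "2 * s + r"
  let ?R = "m * m * ?t + s"
  define E where "E = (adj ?t V)\<^sup>*"
  \<comment> \<open>Only the components meeting \<open>P\<close> are thickened, so the family is
    finite even when \<open>V\<close> is not. Points of the same component contribute the same
    member.\<close>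
  define F where "F = (\<lambda>a. E `` {a} <#> ball s) ` P"
  have comp: "E `` {a} \<subseteq> V" if "a \<in> V" for a
    using adj_component_subset that by (simp add: E_def)
  have compG: "E `` {a} \<subseteq> carrier G" if "a \<in> P" for a
    using comp P V that by blast
  \<comment> \<open>The reflexive-transitive closure is reflexive on the whole type, hence
    \<open>UNIV\<close> rather than \<open>V\<close>.\<close>
  have equivE: "equiv UNIV E"
    unfolding E_def using V by (intro equivI refl_rtrancl sym_rtrancl sym_adj trans_rtrancl) auto
  have "\<Union>F \<in> patch_family G S r ?R"
  proof (rule patch_family_separated_Union)
    show "finite F" using P by (simp add: F_def)
    show "A \<subseteq> carrier G" if "A \<in> F" for A
      using that thickening_closed[OF compG] by (auto simp: F_def)
    show "A \<in> patch_family G S r ?R" if "A \<in> F" for A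
    proof -
      obtain a where a: "a \<in> P" "A = E `` {a} <#> ball s" using \<open>A \<in> F\<close> by (auto simp: F_def)
      have aV: "a \<in> V" "a \<in> carrier G" using a P V by auto
      have "E `` {a} \<in> scale_components G S ?t V"
        using aV by (auto simp: scale_components_def E_def adj_def intro: quotientI)
      from bdd[OF this] have fc: "finite (E `` {a})" "card (E `` {a}) \<le> m" by auto
      have "A \<subseteq> a <# ball ?R"
      proof
        fix c assume "c \<in> A"
        then obtain b where c: "c \<in> carrier G" "b \<in> E `` {a}" "wdist b c \<le> s"
          using mem_thickening_iff compG a by auto
        then have "wdist a b \<le> m * m * ?t"
          using adj_component_bounded[OF V aV(1)] fc by (simp add: E_def)
        moreover have "b \<in> carrier G" using c compG a by blast
        ultimately have "wdist a c \<le> ?R" using c aV wdist_triangle[of a b c] by simp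
        then show "c \<in> a <# ball ?R" using mem_translate_iff c aV by blast
      qed
      then show ?thesis using patch_family.subset patch_family.translate aV(2) by metis
    qed
    fix A B p q assume AB: "A \<in> F" "B \<in> F" "A \<noteq> B" "p \<in> A" "q \<in> B"
    obtain a b where ab: "a \<in> P" "A = E `` {a} <#> ball s" "b \<in> P" "B = E `` {b} <#> ball s"
      using AB by (auto simp: F_def)
    obtain u where u: "u \<in> E `` {a}" "wdist u p \<le> s" "p \<in> carrier G"
      using AB ab mem_thickening_iff[OF compG[OF \<open>a \<in> P\<close>]] by auto
    obtain v where v: "v \<in> E `` {b}" "wdist v q \<le> s" "q \<in> carrier G"
      using AB ab mem_thickening_iff[OF compG[OF \<open>b \<in> P\<close>]] by auto
    have uv: "u \<in> V" "v \<in> V" "u \<in> carrier G" "v \<in> carrier G"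
      using u(1) v(1) comp[of a] comp[of b] ab(1,3) P(2) V by auto
    show "r < wdist p q"
    proof (rule ccontr)
      \<comment> \<open>Going from \<open>u\<close> through \<open>p\<close> and \<open>q\<close> to
        \<open>v\<close> costs at most \<open>s + r + s\<close>, which is the scale itself. So
        \<open>u\<close> and \<open>v\<close> would be adjacent and \<open>A\<close>,
        \<open>B\<close> would come from the same component.\<close>
      assume "\<not> r < wdist p q"
      then have "wdist u v \<le> ?t"
        using wdist_triangle[of u p v] wdist_triangle[of p q v] wdist_commute[of q v] u v uv by simp
      then have "(u, v) \<in> E" using uv by (auto simp: E_def adj_def)
      then have "E `` {u} = E `` {v}" by (rule equiv_class_eq[OF equivE])
      moreover have "E `` {a} = E `` {u}" "E `` {b} = E `` {v}"
        using u(1) v(1) equiv_class_eq[OF equivE] by auto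
      ultimately have "E `` {a} = E `` {b}" by simp
      then show False using AB ab by simp
    qed
  qed
  moreover have "P <#> ball s \<subseteq> \<Union>F"
    by (auto simp: F_def E_def set_mult_def)
  ultimately show ?thesis by (rule patch_family.subset)
qed

section \<open>Merging the colours\<close>

text \<open>Both interiors lie in the almost-union whatever the relative position of
  \<open>A\<close> and \<open>B\<close>, so colour classes that come close to each other can still
  be merged.\<close>

lemma almost_union_thickenings:
  assumes "A \<subseteq> carrier G" "B \<subseteq> carrier G"
  shows "(A \<union> B) <#> ball s \<subseteq> almost_union G S r (A <#> ball (s + r)) (B <#> ball (s + r))"
proof -
  have "(A \<union> B) <#> ball s = (A <#> ball s) \<union> (B <#> ball s)"
    by (auto simp: set_mult_def)
  then show ?thesis
    using thickening_subset_interior[of _ s r] assms by (auto simp: almost_union_def)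
qed

text \<open>\<open>R\<close> is computed from \<open>r\<close>, \<open>d\<close> and the component
  bound \<open>m\<close> at one fixed scale, all chosen before \<open>P\<close>; this gives the
  uniformity that the patching property asks for.\<close>

lemma asdim_finite_subset_in_patch_family:
  assumes "asdim_at_most G S d"
  shows "\<exists>R. \<forall>P. finite P \<longrightarrow> P \<subseteq> carrier G \<longrightarrow> P \<in> patch_family G S r R"
proof -
  define s where "s = (d + 1) * r"
  obtain m and x :: "'a \<Rightarrow> nat" where x: "x \<in> carrier G \<rightarrow> {1..d + 1}"
    and comps: "\<And>c K. c \<in> {1..d + 1} \<Longrightarrow>
      K \<in> scale_components G S (2 * s + r) {a \<in> carrier G. x a = c} \<Longrightarrow> finite K \<and> card K \<le> m"
    using assms unfolding asdim_at_most_def by meson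
  define R where "R = m * m * (2 * s + r) + s"
  have "P \<in> patch_family G S r R" if P: "finite P" "P \<subseteq> carrier G" for P
  proof -
    have colour_range: "x a \<in> {1..d + 1}" if "a \<in> P" for a using x P that by blast
    \<comment> \<open>The bound on components concerns the full colour class, so that class is taken
      as \<open>V\<close>, and \<open>P\<close> selects a finite part of it.\<close>
    have colour: "{a \<in> P. x a = c} <#> ball s \<in> patch_family G S r R" if "c \<in> {1..d + 1}" for c
      unfolding R_def
      by (rule thickened_finite_subset_in_patch_family[where V = "{a \<in> carrier G. x a = c}"])
        (use P comps[OF that] in auto)
    \<comment> \<open>Induction on the number of merged colours: the thickness still available is
      \<open>r\<close> for each colour yet to come. Colours start at 1, so the case
      \<open>k = 0\<close> concerns the empty set.\<close>
    have "{a \<in> P. x a \<le> k} <#> ball ((d + 1 - k) * r) \<in> patch_family G S r R" if "k \<le> d + 1" for k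
      using that
    proof (induction k)
      case 0
      have "{a \<in> P. x a \<le> 0} = {}" using colour_range by fastforce
      then show ?case using patch_family_empty by (simp only: set_mult_def) simp
    next
      case (Suc k)
      define t where "t = (d + 1 - Suc k) * r"
      \<comment> \<open>\<open>Suc k \<le> d + 1\<close> keeps the subtraction from truncating, so
        the thickness drops by exactly \<open>r\<close>.\<close>
      have t: "(d + 1 - k) * r = t + r"
        using Suc.prems by (simp add: t_def Suc_diff_le)
      then have "t + r \<le> s" unfolding s_def by (metis diff_le_self mult_le_mono1)
      then have "{a \<in> P. x a = Suc k} <#> ball (t + r) \<subseteq> {a \<in> P. x a = Suc k} <#> ball s"
        by (intro thickening_mono) auto
      moreover have "{a \<in> P. x a = Suc k} <#> ball s \<in> patch_family G S r R"
        using colour Suc.prems by simp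
      ultimately have new: "{a \<in> P. x a = Suc k} <#> ball (t + r) \<in> patch_family G S r R"
        by (rule patch_family.subset[rotated])
      have old: "{a \<in> P. x a \<le> k} <#> ball (t + r) \<in> patch_family G S r R"
        using Suc t by simp
      have "({a \<in> P. x a \<le> k} \<union> {a \<in> P. x a = Suc k}) <#> ball t \<in> patch_family G S r R"
        by (rule patch_family.subset[OF patch_family.almost_union[OF old new]],
            rule almost_union_thickenings) (use P in auto)
      moreover have "{a \<in> P. x a \<le> k} \<union> {a \<in> P. x a = Suc k} = {a \<in> P. x a \<le> Suc k}"
        by auto
      ultimately show ?case by (simp only: t_def)
    qed
    \<comment> \<open>The thickness is now used up, but thickening by radius 0 still contains
      \<open>P\<close>.\<close>
    from this[of "d + 1"] have "{a \<in> P. x a \<le> d + 1} <#> ball 0 \<in> patch_family G S r R" by simp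
    moreover have "{a \<in> P. x a \<le> d + 1} = P" using colour_range by auto
    ultimately show ?thesis using subset_thickening[OF P(2)] patch_family.subset by metis
  qed
  then show ?thesis by blast
qed

section \<open>From finite sets to balls\<close>

lemma asdim_at_most_patching_property:
  assumes "asdim_at_most G S d"
  shows "patching_property G S"
  unfolding patching_property_def
proof
  fix r
  obtain R where R: "\<And>P. finite P \<Longrightarrow> P \<subseteq> carrier G \<Longrightarrow> P \<in> patch_family G S r R"
    using asdim_finite_subset_in_patch_family[OF assms] by blast
  have "finite (a <# ball n)" for a n
    using finite_ball by (simp add: l_coset_def)
  moreover have "a <# ball n \<subseteq> carrier G" if "a \<in> carrier G" for a n
    using mem_translate_iff[OF that] by (intro subsetI) simp
  ultimately show "\<exists>R. \<forall>n>R. \<forall>a\<in>carrier G. a <# ball n \<in> patch_family G S r R"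
    by (intro exI[of _ R] allI impI ballI R)
qed

end

theorem lemma9p13:
  fixes G :: "('a, 'b) monoid_scheme" and S :: "'a set"
  assumes "group G"
    and "finite_symmetric_generating_set G S"
    and "asdim G S < \<infinity>"
  shows "patching_property G S"
proof -
  interpret word_metric_group G S
    using assms(1,2) by (simp add: word_metric_group_def word_metric_group_axioms_def)
  have "\<exists>d. asdim_at_most G S d"
  proof (rule ccontr)
    assume "\<nexists>d. asdim_at_most G S d"
    \<comment> \<open>The infimum of the empty set in \<open>enat\<close> is
      \<open>\<infinity>\<close>, so finiteness of \<open>asdim\<close> supplies a
      \<open>d\<close>.\<close>
    then show False using assms(3) by (simp add: asdim_def Inf_enat_def)
  qed
  then show ?thesis using asdim_at_most_patching_property by blast
qed

end
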